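(* Let $\Omega\subset\mathbb{R}^2$ be a bounded domain with boundary of class $C^2$. Let $p,q\in(1,\infty)$ and $\mu\in(\frac1p,1]$ be such that $\frac12+\frac1p+\frac1q<\mu\le1$. Then, for fixed $v_0\in V_\mu$, the principal part of Hibler's operator $\mathcal{A}^H(v_0)$ subject to homogeneous Dirichlet boundary conditions satisfies the Lopatinskii-Shapiro condition; that is: for all $x_0\in\partial\Omega$, all $\xi\in\mathbb{R}^2$ with $(\xi\,|\,\nu(x_0))=0$ and all $\lambda\in\mathbb{C}$ with $\operatorname{Re}\lambda\ge0$ and $|\xi|+|\lambda|\neq0$, any solution $w\in C_0(\mathbb{R}_+;\mathbb{C}^2)$ of $$\big(\lambda+\mathcal{A}^H_\#(x_0,\xi-\nu(x_0)D_y)\big)w(y)=0,\quad y>0,\qquad w(0)=0,$$ is identically zero.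
   Context: **Spaces.** $X_0=L_q(\Omega;\mathbb{R}^2)\times L_q(\Omega)\times L_q(\Omega)$ and $$X_1=\{u\in H^2_q(\Omega;\mathbb{R}^2):u=0\text{ on }\partial\Omega\}\times\{h\in H^2_q(\Omega):\partial_\nu h=0\text{ on }\partial\Omega\}\times\{a\in H^2_q(\Omega):\partial_\nu a=0\text{ on }\partial\Omega\}.$$ $X_{\gamma,\mu}=(X_0,X_1)_{\mu-1/p,p}$ (real interpolation), which embeds into $C^1(\overline\Omega)^4$. $V_\mu$ is an open subset of $X_{\gamma,\mu}$ such that all $(u,h,a)\in V_\mu$ satisfy $h\ge\kappa$ for some $\kappa>0$ and $a\in[0,1]$. $\nu(x)$ is the outer unit normal at $x\in\partial\Omega$. **Hibler's operator.** $\delta,e,p^*,c>0$ are fixed constants, $\varepsilon(u)=\frac12(\nabla u+\nabla u^T)$, $P(h,a)=p^*h\exp(-c(1-a))$. The linear map $\mathbb{S}:\mathbb{R}^{2\times2}\to\mathbb{R}^{2\times2}$ is $$\mathbb{S}\varepsilon=\begin{pmatrix}(1+\frac1{e^2})\varepsilon_{11}+(1-\frac1{e^2})\varepsilon_{22}&\frac1{e^2}(\varepsilon_{12}+\varepsilon_{21})\\ \frac1{e^2}(\varepsilon_{12}+\varepsilon_{21})&(1-\frac1{e^2})\varepsilon_{11}+(1+\frac1{e^2})\varepsilon_{22}\end{pmatrix},$$ with coefficients $\mathbb{S}_{ij}^{kl}$ given by $(\mathbb{S}\varepsilon)_{ik}=\sum_{j,l=1}^2\mathbb{S}_{ij}^{kl}\varepsilon_{jl}$.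 Put $\triangle^2(\varepsilon)=\sum_{i,j,k,l}\varepsilon_{ik}\mathbb{S}_{ij}^{kl}\varepsilon_{jl}$, $\triangle_\delta(\varepsilon)=\sqrt{\delta+\triangle^2(\varepsilon)}$. For $v_0=(u_0,h_0,a_0)\in V_\mu$ set, with $\varepsilon=\varepsilon(u_0)$, $$a_{ij}^{kl}=a_{ij}^{kl}(\nabla u_0,P(h_0,a_0))=\frac{P(h_0,a_0)}{2\triangle_\delta(\varepsilon)}\Big(\mathbb{S}_{ij}^{kl}-\frac{1}{\triangle_\delta^2(\varepsilon)}(\mathbb{S}\varepsilon)_{ik}(\mathbb{S}\varepsilon)_{jl}\Big)\in C(\overline\Omega).$$ With $D_m=-\mathrm{i}\partial_m$, Hibler's operator is $$[\mathcal{A}^H(v_0)u]_i=\sum_{j,k,l=1}^2a_{ij}^{kl}D_kD_lu_j-\frac{1}{2\triangle_\delta(\varepsilon(u_0))}\sum_{j=1}^2\big(\partial_jP(h_0,a_0)\big)(\mathbb{S}\varepsilon(u))_{ij},\quad i=1,2,$$ and the symbol of its principal part is $(\mathcal{A}^H_\#(x,\xi))_{ij}=\sum_{k,l=1}^2a_{ij}^{kl}(x)\xi_k\xi_l$. With $D_y=-\mathrm{i}\frac{d}{dy}$, $\mathcal{A}^H_\#(x_0,\xi-\nu(x_0)D_y)$ is the ordinary differential operator $$\big[\mathcal{A}^H_\#(x_0,\xi-\nu(x_0)D_y)w\big]_i=\sum_{j,k,l=1}^2a_{ij}^{kl}(x_0)(\xi_k-\nu_k(x_0)D_y)(\xi_l-\nu_l(x_0)D_y)w_j.$$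 $C_0(\mathbb{R}_+;\mathbb{C}^2)$ denotes the continuous functions on $[0,\infty)$ vanishing at infinity. *)

theory Defs
  imports "HOL-Analysis.Analysis"
begin

section \<open>Derivatives and \<open>C\<^sup>1\<close> up to the boundary\<close>

definition partial :: "2 \<Rightarrow> (real^2 \<Rightarrow> 'b::real_normed_vector) \<Rightarrow> real^2 \<Rightarrow> 'b" where
  "partial j f x = frechet_derivative f (at x) (axis j 1)"

definition iter_partial :: "2 list \<Rightarrow> (real^2 \<Rightarrow> 'b::real_normed_vector) \<Rightarrow> real^2 \<Rightarrow> 'b" where
  "iter_partial js f = foldr partial js f"

definition C1_closure :: "(real^2) set \<Rightarrow> (real^2 \<Rightarrow> 'b::real_normed_vector) set" where
  "C1_closure \<Omega> = {f. continuous_on (closure \<Omega>) f \<and>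
     (\<forall>x\<in>\<Omega>. f differentiable (at x)) \<and>
     (\<forall>j. \<exists>g. continuous_on (closure \<Omega>) g \<and> (\<forall>x\<in>\<Omega>. g x = partial j f x))}"

text \<open>For \<open>f\<close> in \<open>C1_closure \<Omega>\<close> this is the continuous extension of the partial derivative
  from \<open>\<Omega>\<close> to its closure. It depends only on the values of \<open>f\<close> in \<open>\<Omega>\<close>.\<close>

definition partial_closure ::
    "(real^2) set \<Rightarrow> 2 \<Rightarrow> (real^2 \<Rightarrow> 'b::real_normed_vector) \<Rightarrow> real^2 \<Rightarrow> 'b" where
  "partial_closure \<Omega> j f x = Lim (at x within \<Omega>) (partial j f)"

section \<open>Bounded domains of class \<open>C\<^sup>2\<close> and the outer unit normal\<close>

definition C2_fun :: "(real \<Rightarrow> real) \<Rightarrow> bool" where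
  "C2_fun g \<longleftrightarrow> (\<exists>g' g''. (\<forall>t. (g has_real_derivative g' t) (at t)) \<and>
     (\<forall>t. (g' has_real_derivative g'' t) (at t)) \<and> continuous_on UNIV g'')"

text \<open>In the orthogonal coordinates given by \<open>T\<close>, the domain lies above the graph of \<open>g\<close> near \<open>x\<close>.\<close>

definition C2_graph_at ::
    "(real^2) set \<Rightarrow> real^2 \<Rightarrow> real \<Rightarrow> (real \<Rightarrow> real) \<Rightarrow> (real^2 \<Rightarrow> real^2) \<Rightarrow> bool" where
  "C2_graph_at \<Omega> x r g T \<longleftrightarrow> r > 0 \<and> C2_fun g \<and> orthogonal_transformation T \<and>
     \<Omega> \<inter> ball x r = {y \<in> ball x r. T y $ 2 > g (T y $ 1)}"

definition bounded_C2_domain :: "(real^2) set \<Rightarrow> bool" where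
  "bounded_C2_domain \<Omega> \<longleftrightarrow> open \<Omega> \<and> connected \<Omega> \<and> \<Omega> \<noteq> {} \<and> bounded \<Omega> \<and>
     (\<forall>x\<in>frontier \<Omega>. \<exists>r g T. C2_graph_at \<Omega> x r g T)"

text \<open>The vector \<open>n\<close> is independent of the chosen graph representation.\<close>

definition outer_normal :: "(real^2) set \<Rightarrow> real^2 \<Rightarrow> real^2" where
  "outer_normal \<Omega> x = (SOME n. \<exists>r g T. C2_graph_at \<Omega> x r g T \<and>
     T n = (1 / sqrt (1 + (deriv g (T x $ 1))\<^sup>2)) *\<^sub>R vector [deriv g (T x $ 1), - 1])"

section \<open>Lebesgue and Sobolev spaces\<close>

text \<open>Elements of the function spaces are represented by functions, of which only the class
  modulo equality almost everywhere on \<open>\<Omega>\<close> matters; the norms below are seminorms on these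
  representatives.\<close>

definition Lq :: "(real^2) set \<Rightarrow> real \<Rightarrow> (real^2 \<Rightarrow> 'b::euclidean_space) set" where
  "Lq \<Omega> q = {f. f \<in> borel_measurable (lebesgue_on \<Omega>) \<and>
     integrable (lebesgue_on \<Omega>) (\<lambda>x. norm (f x) powr q)}"

definition Lq_norm :: "(real^2) set \<Rightarrow> real \<Rightarrow> (real^2 \<Rightarrow> 'b::euclidean_space) \<Rightarrow> real" where
  "Lq_norm \<Omega> q f = (LINT x|lebesgue_on \<Omega>. norm (f x) powr q) powr (1 / q)"

definition test_fun :: "(real^2) set \<Rightarrow> (real^2 \<Rightarrow> real) \<Rightarrow> bool" where
  "test_fun \<Omega> \<phi> \<longleftrightarrow> (\<forall>js x. iter_partial js \<phi> differentiable (at x)) \<and>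
     (\<exists>K. compact K \<and> K \<subseteq> \<Omega> \<and> (\<forall>x. x \<notin> K \<longrightarrow> \<phi> x = 0))"

definition locally_integrable :: "(real^2) set \<Rightarrow> (real^2 \<Rightarrow> 'b::euclidean_space) \<Rightarrow> bool" where
  "locally_integrable \<Omega> f \<longleftrightarrow> (\<forall>K. compact K \<and> K \<subseteq> \<Omega> \<longrightarrow> integrable (lebesgue_on K) f)"

definition has_weak_partial :: "(real^2) set \<Rightarrow> 2 list \<Rightarrow>
    (real^2 \<Rightarrow> 'b::euclidean_space) \<Rightarrow> (real^2 \<Rightarrow> 'b) \<Rightarrow> bool" where
  "has_weak_partial \<Omega> js f g \<longleftrightarrow> locally_integrable \<Omega> f \<and> locally_integrable \<Omega> g \<and>
     (\<forall>\<phi>. test_fun \<Omega> \<phi> \<longrightarrow>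
       (LINT x|lebesgue_on \<Omega>. iter_partial js \<phi> x *\<^sub>R f x) =
       (- 1) ^ length js *\<^sub>R (LINT x|lebesgue_on \<Omega>. \<phi> x *\<^sub>R g x))"

definition weak_partial :: "(real^2) set \<Rightarrow> 2 list \<Rightarrow>
    (real^2 \<Rightarrow> 'b::euclidean_space) \<Rightarrow> real^2 \<Rightarrow> 'b" where
  "weak_partial \<Omega> js f = (SOME g. has_weak_partial \<Omega> js f g)"

definition sobolev :: "(real^2) set \<Rightarrow> nat \<Rightarrow> real \<Rightarrow> (real^2 \<Rightarrow> 'b::euclidean_space) set" where
  "sobolev \<Omega> m q = {f \<in> Lq \<Omega> q. \<forall>js. length js \<le> m \<longrightarrow> (\<exists>g\<in>Lq \<Omega> q. has_weak_partial \<Omega> js f g)}"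

definition sobolev_norm ::
    "(real^2) set \<Rightarrow> nat \<Rightarrow> real \<Rightarrow> (real^2 \<Rightarrow> 'b::euclidean_space) \<Rightarrow> real" where
  "sobolev_norm \<Omega> m q f = (\<Sum>js | length js \<le> m. Lq_norm \<Omega> q (weak_partial \<Omega> js f))"

definition C1_representative ::
    "(real^2) set \<Rightarrow> (real^2 \<Rightarrow> 'b::euclidean_space) \<Rightarrow> (real^2 \<Rightarrow> 'b) \<Rightarrow> bool" where
  "C1_representative \<Omega> f g \<longleftrightarrow> g \<in> C1_closure \<Omega> \<and> (AE x in lebesgue_on \<Omega>. g x = f x)"

section \<open>Real interpolation (\<open>K\<close>-method)\<close>

definition K_functional :: "('a \<Rightarrow> 'b::real_vector) set \<Rightarrow> (('a \<Rightarrow> 'b) \<Rightarrow> real) \<Rightarrow>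
    ('a \<Rightarrow> 'b) set \<Rightarrow> (('a \<Rightarrow> 'b) \<Rightarrow> real) \<Rightarrow> real \<Rightarrow> ('a \<Rightarrow> 'b) \<Rightarrow> real" where
  "K_functional X0 N0 X1 N1 t v =
     Inf {N0 a + t * N1 b | a b. a \<in> X0 \<and> b \<in> X1 \<and> v = (\<lambda>x. a x + b x)}"

definition interp_integral :: "('a \<Rightarrow> 'b::real_vector) set \<Rightarrow> (('a \<Rightarrow> 'b) \<Rightarrow> real) \<Rightarrow>
    ('a \<Rightarrow> 'b) set \<Rightarrow> (('a \<Rightarrow> 'b) \<Rightarrow> real) \<Rightarrow> real \<Rightarrow> real \<Rightarrow> ('a \<Rightarrow> 'b) \<Rightarrow> ennreal" where
  "interp_integral X0 N0 X1 N1 \<theta> p v = (\<integral>\<^sup>+ t\<in>{0<..}.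
     ennreal ((t powr (- \<theta>) * K_functional X0 N0 X1 N1 t v) powr p / t) \<partial>lborel)"

definition interp_space :: "('a \<Rightarrow> 'b::real_vector) set \<Rightarrow> (('a \<Rightarrow> 'b) \<Rightarrow> real) \<Rightarrow>
    ('a \<Rightarrow> 'b) set \<Rightarrow> (('a \<Rightarrow> 'b) \<Rightarrow> real) \<Rightarrow> real \<Rightarrow> real \<Rightarrow> ('a \<Rightarrow> 'b) set" where
  "interp_space X0 N0 X1 N1 \<theta> p =
     {v. (\<exists>a\<in>X0. \<exists>b\<in>X1. v = (\<lambda>x. a x + b x)) \<and> interp_integral X0 N0 X1 N1 \<theta> p v < \<infinity>}"

definition interp_norm :: "('a \<Rightarrow> 'b::real_vector) set \<Rightarrow> (('a \<Rightarrow> 'b) \<Rightarrow> real) \<Rightarrow>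
    ('a \<Rightarrow> 'b) set \<Rightarrow> (('a \<Rightarrow> 'b) \<Rightarrow> real) \<Rightarrow> real \<Rightarrow> real \<Rightarrow> ('a \<Rightarrow> 'b) \<Rightarrow> real" where
  "interp_norm X0 N0 X1 N1 \<theta> p v = enn2real (interp_integral X0 N0 X1 N1 \<theta> p v) powr (1 / p)"

section \<open>The spaces of states\<close>

text \<open>A state \<open>v = (u, h, a)\<close> is a function with values in \<open>\<real>\<^sup>2 \<times> \<real> \<times> \<real>\<close>.\<close>

type_synonym state = "real^2 \<Rightarrow> (real^2) \<times> real \<times> real"

definition vel :: "state \<Rightarrow> real^2 \<Rightarrow> real^2" where "vel v x = fst (v x)"
definition thick :: "state \<Rightarrow> real^2 \<Rightarrow> real" where "thick v x = fst (snd (v x))"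
definition conc :: "state \<Rightarrow> real^2 \<Rightarrow> real" where "conc v x = snd (snd (v x))"

definition X0 :: "(real^2) set \<Rightarrow> real \<Rightarrow> state set" where
  "X0 \<Omega> q = {v. vel v \<in> Lq \<Omega> q \<and> thick v \<in> Lq \<Omega> q \<and> conc v \<in> Lq \<Omega> q}"

definition X0_norm :: "(real^2) set \<Rightarrow> real \<Rightarrow> state \<Rightarrow> real" where
  "X0_norm \<Omega> q v = Lq_norm \<Omega> q (vel v) + Lq_norm \<Omega> q (thick v) + Lq_norm \<Omega> q (conc v)"

text \<open>Boundary values are those of the representative in \<open>C\<^sup>1\<close> up to the boundary. It exists
  for every \<open>H\<^sup>2\<^sub>q\<close> function if \<open>q > 2\<close>, which \<open>1/2 + 1/p + 1/q < \<mu> \<le> 1\<close> implies.\<close>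

definition dirichlet_zero :: "(real^2) set \<Rightarrow> (real^2 \<Rightarrow> 'b::euclidean_space) \<Rightarrow> bool" where
  "dirichlet_zero \<Omega> f \<longleftrightarrow> (\<exists>g. C1_representative \<Omega> f g \<and> (\<forall>x\<in>frontier \<Omega>. g x = 0))"

definition neumann_zero :: "(real^2) set \<Rightarrow> (real^2 \<Rightarrow> real) \<Rightarrow> bool" where
  "neumann_zero \<Omega> f \<longleftrightarrow> (\<exists>g. C1_representative \<Omega> f g \<and>
     (\<forall>x\<in>frontier \<Omega>. (\<Sum>j\<in>UNIV. outer_normal \<Omega> x $ j * partial_closure \<Omega> j g x) = 0))"

definition X1 :: "(real^2) set \<Rightarrow> real \<Rightarrow> state set" where
  "X1 \<Omega> q = {v. vel v \<in> sobolev \<Omega> 2 q \<and> dirichlet_zero \<Omega> (vel v) \<and>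
     thick v \<in> sobolev \<Omega> 2 q \<and> neumann_zero \<Omega> (thick v) \<and>
     conc v \<in> sobolev \<Omega> 2 q \<and> neumann_zero \<Omega> (conc v)}"

definition X1_norm :: "(real^2) set \<Rightarrow> real \<Rightarrow> state \<Rightarrow> real" where
  "X1_norm \<Omega> q v =
     sobolev_norm \<Omega> 2 q (vel v) + sobolev_norm \<Omega> 2 q (thick v) + sobolev_norm \<Omega> 2 q (conc v)"

definition X_gamma :: "(real^2) set \<Rightarrow> real \<Rightarrow> real \<Rightarrow> real \<Rightarrow> state set" where
  "X_gamma \<Omega> p q \<mu> =
     interp_space (X0 \<Omega> q) (X0_norm \<Omega> q) (X1 \<Omega> q) (X1_norm \<Omega> q) (\<mu> - 1 / p) p"

definition X_gamma_norm :: "(real^2) set \<Rightarrow> real \<Rightarrow> real \<Rightarrow> real \<Rightarrow> state \<Rightarrow> real" where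
  "X_gamma_norm \<Omega> p q \<mu> =
     interp_norm (X0 \<Omega> q) (X0_norm \<Omega> q) (X1 \<Omega> q) (X1_norm \<Omega> q) (\<mu> - 1 / p) p"

definition open_in_X_gamma :: "(real^2) set \<Rightarrow> real \<Rightarrow> real \<Rightarrow> real \<Rightarrow> state set \<Rightarrow> bool" where
  "open_in_X_gamma \<Omega> p q \<mu> V \<longleftrightarrow> V \<subseteq> X_gamma \<Omega> p q \<mu> \<and>
     (\<forall>v\<in>V. \<exists>r>0. \<forall>w\<in>X_gamma \<Omega> p q \<mu>. X_gamma_norm \<Omega> p q \<mu> (\<lambda>x. w x - v x) < r \<longrightarrow> w \<in> V)"

section \<open>Hibler's operator\<close>

definition hibler_S :: "real \<Rightarrow> real^2^2 \<Rightarrow> real^2^2" where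
  "hibler_S e \<epsilon> = vector
     [vector [(1 + 1/e\<^sup>2) * \<epsilon>$1$1 + (1 - 1/e\<^sup>2) * \<epsilon>$2$2, 1/e\<^sup>2 * (\<epsilon>$1$2 + \<epsilon>$2$1)],
      vector [1/e\<^sup>2 * (\<epsilon>$1$2 + \<epsilon>$2$1), (1 - 1/e\<^sup>2) * \<epsilon>$1$1 + (1 + 1/e\<^sup>2) * \<epsilon>$2$2]]"

text \<open>\<open>S_coeff e i j k l\<close> is \<open>S\<^sub>i\<^sub>j\<^sup>k\<^sup>l\<close>: lower indices first, then upper ones. The argument of
  \<open>hibler_S\<close> is the matrix with the single entry 1 at position \<open>(j, l)\<close>.\<close>

definition S_coeff :: "real \<Rightarrow> 2 \<Rightarrow> 2 \<Rightarrow> 2 \<Rightarrow> 2 \<Rightarrow> real" where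
  "S_coeff e i j k l = hibler_S e (axis j (axis l 1)) $ i $ k"

lemma hibler_S_eq_sum:
  "hibler_S e \<epsilon> $ i $ k = (\<Sum>j\<in>UNIV. \<Sum>l\<in>UNIV. S_coeff e i j k l * \<epsilon> $ j $ l)"
  using exhaust_2[of i] exhaust_2[of k]
  by (auto simp: S_coeff_def hibler_S_def sum_2 axis_def algebra_simps)

definition triangle_sq :: "real \<Rightarrow> real^2^2 \<Rightarrow> real" where
  "triangle_sq e \<epsilon> = (\<Sum>i\<in>UNIV. \<Sum>j\<in>UNIV. \<Sum>k\<in>UNIV. \<Sum>l\<in>UNIV.
     \<epsilon> $ i $ k * S_coeff e i j k l * \<epsilon> $ j $ l)"

definition triangle_delta :: "real \<Rightarrow> real \<Rightarrow> real^2^2 \<Rightarrow> real" where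
  "triangle_delta \<delta> e \<epsilon> = sqrt (\<delta> + triangle_sq e \<epsilon>)"

definition ice_strength :: "real \<Rightarrow> real \<Rightarrow> real \<Rightarrow> real \<Rightarrow> real" where
  "ice_strength pstar c h a = pstar * h * exp (- c * (1 - a))"

definition strain :: "(real^2) set \<Rightarrow> (real^2 \<Rightarrow> real^2) \<Rightarrow> real^2 \<Rightarrow> real^2^2" where
  "strain \<Omega> u x = (\<chi> i j. (partial_closure \<Omega> j u x $ i + partial_closure \<Omega> i u x $ j) / 2)"

definition weak_strain :: "(real^2) set \<Rightarrow> (real^2 \<Rightarrow> real^2) \<Rightarrow> real^2 \<Rightarrow> real^2^2" where
  "weak_strain \<Omega> u x = (\<chi> i j. (weak_partial \<Omega> [j] u x $ i + weak_partial \<Omega> [i] u x $ j) / 2)"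

text \<open>\<open>hibler_coeff \<dots> x i j k l\<close> is \<open>a\<^sub>i\<^sub>j\<^sup>k\<^sup>l(x)\<close>, with the index order of \<open>S_coeff\<close>.
  Here \<open>v\<close> has to be the representative in \<open>C1_closure \<Omega>\<close>.\<close>

definition hibler_coeff :: "real \<Rightarrow> real \<Rightarrow> real \<Rightarrow> real \<Rightarrow> (real^2) set \<Rightarrow> state \<Rightarrow>
    real^2 \<Rightarrow> 2 \<Rightarrow> 2 \<Rightarrow> 2 \<Rightarrow> 2 \<Rightarrow> real" where
  "hibler_coeff \<delta> e pstar c \<Omega> v x i j k l =
     (let \<epsilon> = strain \<Omega> (vel v) x in
       ice_strength pstar c (thick v x) (conc v x) / (2 * triangle_delta \<delta> e \<epsilon>) *
       (S_coeff e i j k l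
         - 1 / (triangle_delta \<delta> e \<epsilon>)\<^sup>2 * (hibler_S e \<epsilon> $ i $ k) * (hibler_S e \<epsilon> $ j $ l)))"

text \<open>The operator with components \<open>\<Sum>\<^sub>j\<^sub>k\<^sub>l A\<^sub>i\<^sub>j\<^sup>k\<^sup>l D\<^sub>k D\<^sub>l u\<^sub>j\<close>, where \<open>D\<^sub>m = -\<i> \<partial>\<^sub>m\<close>
  and hence \<open>D\<^sub>k D\<^sub>l = - \<partial>\<^sub>k \<partial>\<^sub>l\<close>.\<close>

definition second_order_op :: "(real^2) set \<Rightarrow> (real^2 \<Rightarrow> 2 \<Rightarrow> 2 \<Rightarrow> 2 \<Rightarrow> 2 \<Rightarrow> real) \<Rightarrow>
    (real^2 \<Rightarrow> real^2) \<Rightarrow> real^2 \<Rightarrow> real^2" where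
  "second_order_op \<Omega> A u x = (\<chi> i. \<Sum>j\<in>UNIV. \<Sum>k\<in>UNIV. \<Sum>l\<in>UNIV.
     A x i j k l * (- (weak_partial \<Omega> [k, l] u x $ j)))"

text \<open>The full operator is recorded only to exhibit its principal part, the second-order operator
  with coefficients \<open>hibler_coeff\<close>; the Lopatinskii-Shapiro condition involves nothing else.\<close>

definition hibler_operator :: "real \<Rightarrow> real \<Rightarrow> real \<Rightarrow> real \<Rightarrow> (real^2) set \<Rightarrow> state \<Rightarrow>
    (real^2 \<Rightarrow> real^2) \<Rightarrow> real^2 \<Rightarrow> real^2" where
  "hibler_operator \<delta> e pstar c \<Omega> v u x =
     second_order_op \<Omega> (hibler_coeff \<delta> e pstar c \<Omega> v) u x
     - (\<chi> i. 1 / (2 * triangle_delta \<delta> e (strain \<Omega> (vel v) x)) *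
         (\<Sum>j\<in>UNIV. partial_closure \<Omega> j (\<lambda>z. ice_strength pstar c (thick v z) (conc v z)) x *
           hibler_S e (weak_strain \<Omega> u x) $ i $ j))"

section \<open>The Lopatinskii-Shapiro condition for Dirichlet boundary conditions\<close>

text \<open>The symbol \<open>(\<Sum>\<^sub>k\<^sub>l A\<^sub>i\<^sub>j\<^sup>k\<^sup>l(x) X\<^sub>k X\<^sub>l)\<^sub>i\<^sub>j\<close> applied to \<open>w\<close>, where operators
  \<open>X\<^sub>1, X\<^sub>2\<close> on functions of one variable are inserted for the covariables. Multiplication by
  \<open>\<xi>\<^sub>1, \<xi>\<^sub>2\<close> gives the symbol at \<open>(x, \<xi>)\<close>.\<close>

definition symbol_apply :: "(real^2 \<Rightarrow> 2 \<Rightarrow> 2 \<Rightarrow> 2 \<Rightarrow> 2 \<Rightarrow> real) \<Rightarrow> real^2 \<Rightarrow>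
    (2 \<Rightarrow> (real \<Rightarrow> complex) \<Rightarrow> real \<Rightarrow> complex) \<Rightarrow> (real \<Rightarrow> complex^2) \<Rightarrow> real \<Rightarrow> complex^2" where
  "symbol_apply A x X w y = (\<chi> i. \<Sum>j\<in>UNIV. \<Sum>k\<in>UNIV. \<Sum>l\<in>UNIV.
     complex_of_real (A x i j k l) * X k (X l (\<lambda>s. w s $ j)) y)"

definition D_y :: "(real \<Rightarrow> complex) \<Rightarrow> real \<Rightarrow> complex" where
  "D_y f y = - \<i> * vector_derivative f (at y)"

text \<open>The \<open>k\<close>-th component of \<open>\<xi> - n D\<^sub>y\<close>.\<close>

definition half_line_covariable ::
    "real^2 \<Rightarrow> real^2 \<Rightarrow> 2 \<Rightarrow> (real \<Rightarrow> complex) \<Rightarrow> real \<Rightarrow> complex" where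
  "half_line_covariable \<xi> n k f y =
     complex_of_real (\<xi> $ k) * f y - complex_of_real (n $ k) * D_y f y"

definition C0_half_line :: "(real \<Rightarrow> complex^2) set" where
  "C0_half_line = {w. continuous_on {0..} w \<and> (w \<longlongrightarrow> 0) at_top}"

definition twice_differentiable_pos :: "(real \<Rightarrow> complex^2) \<Rightarrow> bool" where
  "twice_differentiable_pos w \<longleftrightarrow> (\<forall>y>0. w differentiable (at y) \<and>
     (\<lambda>s. vector_derivative w (at s)) differentiable (at y))"

definition lopatinskii_shapiro_dirichlet ::
    "(real^2) set \<Rightarrow> (real^2 \<Rightarrow> 2 \<Rightarrow> 2 \<Rightarrow> 2 \<Rightarrow> 2 \<Rightarrow> real) \<Rightarrow> bool" where
  "lopatinskii_shapiro_dirichlet \<Omega> A \<longleftrightarrow>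
     (\<forall>x0\<in>frontier \<Omega>. \<forall>\<xi>::real^2. \<forall>\<zeta>::complex.
       \<xi> \<bullet> outer_normal \<Omega> x0 = 0 \<and> Re \<zeta> \<ge> 0 \<and> norm \<xi> + norm \<zeta> \<noteq> 0 \<longrightarrow>
       (\<forall>w. w \<in> C0_half_line \<and> twice_differentiable_pos w \<and>
          (\<forall>y>0. \<zeta> *s w y
             + symbol_apply A x0 (half_line_covariable \<xi> (outer_normal \<Omega> x0)) w y = 0) \<and>
          w 0 = 0 \<longrightarrow> (\<forall>y\<ge>0. w y = 0)))"

end

theory Submission
  imports Defs
begin

text \<open>
  The proof is an energy argument on the half-line, carried out pointwise. Fix a boundary
  point, let \<open>n\<close> be its unit normal and \<open>\<xi>\<close> be tangential. With the matrix field \<open>d\<^sub>j\<^sub>l = (\<xi>\<^sub>l - n\<^sub>l D\<^sub>y) w\<^sub>j = \<xi>\<^sub>l w\<^sub>j + \<i> n\<^sub>l w\<^sub>j'\<close> and the flux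
  \<open>F = \<i> \<Sum> a\<^sub>i\<^sub>j\<^sup>k\<^sup>l n\<^sub>k cnj w\<^sub>i d\<^sub>j\<^sub>l\<close>, the equation multiplied by \<open>cnj w\<close> becomes
  \<open>F' = - \<zeta> |w|\<^sup>2 - \<Sum> a\<^sub>i\<^sub>j\<^sup>k\<^sup>l cnj d\<^sub>i\<^sub>k d\<^sub>j\<^sub>l\<close>. The form on the right is
  nonnegative and \<open>Re \<zeta> \<ge> 0\<close>, so \<open>Re F\<close> decreases.
  Moreover \<open>2 Re F\<close> equals \<open>- \<phi>'\<close> up to a term quadratic in \<open>w\<close>, where
  \<open>\<phi> = \<Sum> a\<^sub>i\<^sub>j\<^sup>k\<^sup>l n\<^sub>k n\<^sub>l cnj w\<^sub>i w\<^sub>j \<ge> 0\<close> vanishes at \<open>0\<close> and at infinity. If \<open>Re F\<close> were negative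
  somewhere, then \<open>\<phi>\<close> would grow linearly at infinity; if it were positive somewhere, then \<open>\<phi>\<close>
  would fall below its limit at \<open>0\<close>. Hence \<open>Re F = 0\<close> (\<open>flux_vanishes\<close>), and the form vanishes on \<open>d\<close>.

  A form that is positive modulo skew-symmetric matrices forces \<open>d\<close> to be skew. Contracting
  \<open>d\<^sub>i\<^sub>k + d\<^sub>k\<^sub>i = 0\<close> with \<open>n\<close> once and twice, and using \<open>\<xi> \<perp> n\<close>, gives first \<open>n \<bullet> w' = 0\<close>, then
  \<open>n \<bullet> w = 0\<close>, and finally \<open>w' = 0\<close>, so that \<open>w = 0\<close> (\<open>half_line_uniqueness\<close>).

  Hibler's coefficients have this positivity (\<open>sym_definite_hibler_coeff\<close>). The negative rank-one
  part is controlled by Cauchy--Schwarz for the form of \<open>S\<close>, and the regularisation \<open>\<delta> > 0\<close> leaves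
  the fraction \<open>\<delta> / \<triangle>\<^sub>\<delta>\<^sup>2\<close> of that form. Its kernel consists of the skew matrices.
  The prefactor is positive because the bound on the ice thickness carries over from almost all
  points of the domain to the boundary by continuity (\<open>AE_lower_bound_closure\<close>).
\<close>

section \<open>Forms given by fourth-order tensors\<close>

text \<open>The scalars are arbitrary because positivity is a condition on real matrices, while the
  differential equation produces complex ones.\<close>

definition tensor_form ::
    "('n \<Rightarrow> 'n \<Rightarrow> 'n \<Rightarrow> 'n \<Rightarrow> real) \<Rightarrow> ('n::finite \<Rightarrow> 'n \<Rightarrow> 'a::real_algebra_1) \<Rightarrow> ('n \<Rightarrow> 'n \<Rightarrow> 'a) \<Rightarrow> 'a"
  where "tensor_form A E G =
    (\<Sum>i\<in>UNIV. \<Sum>j\<in>UNIV. \<Sum>k\<in>UNIV. \<Sum>l\<in>UNIV. of_real (A i j k l) * (E i k * G j l))"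

text \<open>The matrices with \<open>E i k + E k i = 0\<close> have to be excepted: a tensor that acts on the
  symmetric part of a gradient, as in elasticity, vanishes on all of them.\<close>

definition sym_definite :: "('n::finite \<Rightarrow> 'n \<Rightarrow> 'n \<Rightarrow> 'n \<Rightarrow> real) \<Rightarrow> bool" where
  "sym_definite A \<longleftrightarrow> (\<forall>i j k l. A i j k l = A j i l k) \<and>
     (\<forall>E::'n \<Rightarrow> 'n \<Rightarrow> real. 0 \<le> tensor_form A E E) \<and>
     (\<forall>E::'n \<Rightarrow> 'n \<Rightarrow> real. tensor_form A E E = 0 \<longrightarrow> (\<forall>i k. E i k + E k i = 0))"

lemma tensor_form_commute:
  fixes E G :: "'n::finite \<Rightarrow> 'n \<Rightarrow> 'a::{real_algebra_1,comm_ring_1}"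
  assumes "\<And>i j k l. A i j k l = A j i l k"
  shows "tensor_form A E G = tensor_form A G E"
proof -
  have "tensor_form A E G =
    (\<Sum>i\<in>UNIV. \<Sum>j\<in>UNIV. \<Sum>l\<in>UNIV. \<Sum>k\<in>UNIV. of_real (A i j k l) * (E i k * G j l))"
    unfolding tensor_form_def
    by (rule sum.cong[OF refl], rule sum.cong[OF refl], rule sum.swap)
  also have "\<dots> =
    (\<Sum>j\<in>UNIV. \<Sum>i\<in>UNIV. \<Sum>l\<in>UNIV. \<Sum>k\<in>UNIV. of_real (A i j k l) * (E i k * G j l))"
    by (rule sum.swap)
  also have "\<dots> = tensor_form A G E"
    unfolding tensor_form_def by (intro sum.cong refl) (metis assms mult.commute)
  finally show ?thesis .
qed

text \<open>Since the tensor is real, complex matrices inherit positivity from their real and imaginary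
  parts.\<close>

lemma Re_tensor_form_cnj:
  fixes E :: "'n::finite \<Rightarrow> 'n \<Rightarrow> complex"
  shows "Re (tensor_form A (\<lambda>i k. cnj (E i k)) E) =
     tensor_form A (\<lambda>i k. Re (E i k)) (\<lambda>i k. Re (E i k)) +
     tensor_form A (\<lambda>i k. Im (E i k)) (\<lambda>i k. Im (E i k))"
  by (simp add: tensor_form_def sum.distrib[symmetric] distrib_left)

lemma has_vector_derivative_tensor_form:
  fixes E G :: "real \<Rightarrow> 'n::finite \<Rightarrow> 'n \<Rightarrow> complex"
  assumes "\<And>i k. ((\<lambda>s. E s i k) has_vector_derivative E' i k) (at y)"
    and "\<And>i k. ((\<lambda>s. G s i k) has_vector_derivative G' i k) (at y)"
  shows "((\<lambda>s. tensor_form A (E s) (G s)) has_vector_derivative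
            tensor_form A (E y) G' + tensor_form A E' (G y)) (at y)"
proof -
  have "((\<lambda>s. tensor_form A (E s) (G s)) has_vector_derivative
     (\<Sum>i\<in>UNIV. \<Sum>j\<in>UNIV. \<Sum>k\<in>UNIV. \<Sum>l\<in>UNIV.
        of_real (A i j k l) * (E y i k * G' j l + E' i k * G y j l))) (at y)"
    unfolding tensor_form_def
    by (intro has_vector_derivative_sum has_vector_derivative_mult_right
        has_vector_derivative_mult assms)
  then show ?thesis
    by (simp add: tensor_form_def sum.distrib distrib_left)
qed

section \<open>A monotone flux that vanishes\<close>

text \<open>A flux \<open>f\<close> that decreases and vanishes at both ends is zero. The flux of the energy identity
  contains a derivative of the solution, whose behaviour at the ends is unknown, so its boundary
  values are replaced by those of a potential: \<open>f\<close> is \<open>- \<phi>' / 2\<close> plus a term \<open>r\<close> that vanishes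
  at both ends. A nonzero value of \<open>f\<close> persists, by monotonicity, towards one of the
  ends and forces a definite slope on \<open>\<phi>\<close> there.\<close>

lemma flux_vanishes:
  fixes f r \<phi> :: "real \<Rightarrow> real"
  assumes anti: "\<And>y z. 0 < y \<Longrightarrow> y \<le> z \<Longrightarrow> f z \<le> f y"
    and deriv: "\<And>y. 0 < y \<Longrightarrow> (\<phi> has_real_derivative 2 * (r y - f y)) (at y)"
    and nonneg: "\<And>y. 0 < y \<Longrightarrow> 0 \<le> \<phi> y"
    and \<phi>0: "(\<phi> \<longlongrightarrow> 0) (at_right 0)" and \<phi>inf: "(\<phi> \<longlongrightarrow> 0) at_top"
    and r0: "(r \<longlongrightarrow> 0) (at_right 0)" and rinf: "(r \<longlongrightarrow> 0) at_top"
    and "0 < y"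
  shows "f y = 0"
proof (rule ccontr)
  assume "f y \<noteq> 0"
  then consider "f y < 0" | "f y > 0" by linarith
  then show False
  proof cases
    \<comment> \<open>Near infinity \<open>f \<le> f y\<close> and \<open>r > f y / 2\<close>, so \<open>\<phi>\<close> has slope at least \<open>- f y > 0\<close>.\<close>
    case 1
    have "eventually (\<lambda>z. f y / 2 < r z) at_top"
      using order_tendstoD(1)[OF rinf, of "f y / 2"] 1 by simp
    moreover have "eventually (\<lambda>z. y \<le> z) at_top"
      by (rule eventually_ge_at_top)
    ultimately have "eventually (\<lambda>z. f y / 2 < r z \<and> y \<le> z) at_top"
      by eventually_elim simp
    then obtain N where N: "\<And>z. z \<ge> N \<Longrightarrow> f y / 2 < r z \<and> y \<le> z"
      unfolding eventually_at_top_linorder by blast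
    define m where "m = max N y"
    have grow: "\<phi> m - f y * (z - m) \<le> \<phi> z" if "m \<le> z" for z
    proof -
      have "\<phi> m + f y * m \<le> \<phi> z + f y * z"
      proof (rule DERIV_nonneg_imp_nondecreasing[OF that, of "\<lambda>s. \<phi> s + f y * s"])
        fix s assume s: "m \<le> s" "s \<le> z"
        then have "f s \<le> f y" "f y / 2 < r s" "0 < s"
          using N[of s] anti[of y s] \<open>0 < y\<close> by (auto simp: m_def)
        moreover have "((\<lambda>s. \<phi> s + f y * s) has_real_derivative 2 * (r s - f s) + f y) (at s)"
          using deriv[OF \<open>0 < s\<close>] by (auto intro!: derivative_eq_intros)
        ultimately show "\<exists>d. ((\<lambda>s. \<phi> s + f y * s) has_real_derivative d) (at s) \<and> 0 \<le> d"
          by (intro exI[of _ "2 * (r s - f s) + f y"]) auto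
      qed
      then show ?thesis by (simp add: algebra_simps)
    qed
    have "0 \<le> \<phi> m" using nonneg[of m] \<open>0 < y\<close> by (simp add: m_def)
    have "eventually (\<lambda>z. \<phi> z < - f y) at_top"
      using order_tendstoD(2)[OF \<phi>inf, of "- f y"] 1 by simp
    then obtain M where M: "\<And>z. z \<ge> M \<Longrightarrow> \<phi> z < - f y"
      unfolding eventually_at_top_linorder by blast
    define z where "z = max M (m + 1)"
    have "- f y * 1 \<le> - f y * (z - m)"
      using 1 by (intro mult_left_mono) (auto simp: z_def)
    moreover have "m \<le> z" "M \<le> z" by (auto simp: z_def)
    ultimately show False
      using grow[of z] M[of z] \<open>0 \<le> \<phi> m\<close> by linarith
  next
    \<comment> \<open>Near \<open>0\<close> the slope of \<open>\<phi>\<close> is at most \<open>- f y < 0\<close>, so \<open>\<phi>\<close> drops below its limit \<open>0\<close>.\<close>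
    case 2
    have "eventually (\<lambda>z. r z < f y / 2) (at_right 0)"
      using order_tendstoD(2)[OF r0, of "f y / 2"] 2 by simp
    then obtain b where b: "0 < b" "\<And>z. 0 < z \<Longrightarrow> z < b \<Longrightarrow> r z < f y / 2"
      by (auto simp: eventually_at_right_field)
    define m where "m = min (b / 2) y"
    have m: "0 < m" "m < b" "m \<le> y" using b(1) \<open>0 < y\<close> by (auto simp: m_def)
    have grow: "\<phi> m + f y * (m - s) \<le> \<phi> s" if s: "0 < s" "s \<le> m" for s
    proof -
      have "\<phi> m + f y * m \<le> \<phi> s + f y * s"
      proof (rule DERIV_nonpos_imp_nonincreasing[OF s(2), of "\<lambda>s. \<phi> s + f y * s"])
        fix t assume t: "s \<le> t" "t \<le> m"
        then have "f y \<le> f t" "r t < f y / 2" "0 < t"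
          using b(2)[of t] anti[of t y] m s by auto
        moreover have "((\<lambda>s. \<phi> s + f y * s) has_real_derivative 2 * (r t - f t) + f y) (at t)"
          using deriv[OF \<open>0 < t\<close>] by (auto intro!: derivative_eq_intros)
        ultimately show "\<exists>d. ((\<lambda>s. \<phi> s + f y * s) has_real_derivative d) (at t) \<and> d \<le> 0"
          by (intro exI[of _ "2 * (r t - f t) + f y"]) auto
      qed
      then show ?thesis by (simp add: algebra_simps)
    qed
    have "((\<lambda>s. \<phi> m + f y * (m - s)) \<longlongrightarrow> \<phi> m + f y * (m - 0)) (at_right 0)"
      by (intro tendsto_intros)
    moreover have "eventually (\<lambda>s. \<phi> m + f y * (m - s) \<le> \<phi> s) (at_right 0)"
      unfolding eventually_at_right_field using grow m(1) by (intro exI[of _ m]) auto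
    ultimately have "\<phi> m + f y * (m - 0) \<le> 0"
      using \<phi>0 by (intro tendsto_le[of "at_right (0::real)"]) auto
    then show False
      using nonneg[OF m(1)] 2 m(1) by (smt (verit) mult_pos_pos)
  qed
qed

section \<open>Uniqueness on the half-line\<close>

lemma constant_zero_on_half_line:
  fixes f :: "real \<Rightarrow> 'a::real_normed_vector"
  assumes d: "\<And>y. 0 < y \<Longrightarrow> (f has_vector_derivative 0) (at y)"
    and lim: "(f \<longlongrightarrow> 0) (at_right 0)" and "0 < y"
  shows "f y = 0"
proof -
  obtain C where "\<And>s. s \<in> {0<..} \<Longrightarrow> f s = C"
    by (rule has_vector_derivative_zero_constant[of "{0<..}" f])
      (use d in \<open>auto intro: has_vector_derivative_at_within\<close>)
  then have "f s = f y" if "0 < s" for s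
    using that \<open>0 < y\<close> by simp
  then have "eventually (\<lambda>s. f s = f y) (at_right 0)"
    by (auto simp: eventually_at_right_field intro: exI[of _ 1])
  then have "(f \<longlongrightarrow> f y) (at_right 0)"
    by (rule tendsto_eventually)
  with lim show ?thesis
    by (metis tendsto_unique trivial_limit_at_right_real)
qed

text \<open>The energy argument. Here \<open>d\<close> is \<open>w\<close> with the covariables \<open>\<xi> - n D\<^sub>y\<close> applied to it, \<open>d'\<close> is
  the derivative of \<open>d\<close>, and the equation is written as a first-order equation for \<open>d\<close>: this makes
  it the product rule for the flux \<open>F\<close>.\<close>

lemma half_line_uniqueness:
  fixes A :: "'n::finite \<Rightarrow> 'n \<Rightarrow> 'n \<Rightarrow> 'n \<Rightarrow> real" and \<xi> n :: "'n \<Rightarrow> real"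
    and W W' W'' :: "'n \<Rightarrow> real \<Rightarrow> complex" and \<zeta> :: complex
  defines "d \<equiv> \<lambda>y j l. of_real (\<xi> l) * W j y + \<i> * of_real (n l) * W' j y"
    and "d' \<equiv> \<lambda>y j l. of_real (\<xi> l) * W' j y + \<i> * of_real (n l) * W'' j y"
  assumes A: "sym_definite A"
    and perp: "(\<Sum>l\<in>UNIV. \<xi> l * n l) = 0" and n: "(\<Sum>l\<in>UNIV. n l * n l) \<noteq> 0"
    and \<zeta>: "0 \<le> Re \<zeta>"
    and W: "\<And>j y. 0 < y \<Longrightarrow> (W j has_vector_derivative W' j y) (at y)"
    and W': "\<And>j y. 0 < y \<Longrightarrow> (W' j has_vector_derivative W'' j y) (at y)"
    and ode: "\<And>i y. 0 < y \<Longrightarrow> \<zeta> * W i y + (\<Sum>j\<in>UNIV. \<Sum>k\<in>UNIV. \<Sum>l\<in>UNIV.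
        of_real (A i j k l) * (of_real (\<xi> k) * d y j l + \<i> * of_real (n k) * d' y j l)) = 0"
    and W0: "\<And>j. (W j \<longlongrightarrow> 0) (at_right 0)" and Winf: "\<And>j. (W j \<longlongrightarrow> 0) at_top"
    and "0 < y"
  shows "W j y = 0"
proof -
  have sym: "\<And>i j k l. A i j k l = A j i l k"
    and nonneg: "\<And>E::'n \<Rightarrow> 'n \<Rightarrow> real. 0 \<le> tensor_form A E E"
    and definite: "\<And>E::'n \<Rightarrow> 'n \<Rightarrow> real. tensor_form A E E = 0 \<Longrightarrow> (\<forall>i k. E i k + E k i = 0)"
    using A unfolding sym_definite_def by blast+
  have herm_nonneg: "0 \<le> Re (tensor_form A (\<lambda>i k. cnj (E i k)) E)" for E :: "'n \<Rightarrow> 'n \<Rightarrow> complex"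
    unfolding Re_tensor_form_cnj by (intro add_nonneg_nonneg nonneg)
  \<comment> \<open>\<open>cW\<close> and \<open>nW\<close> are the rank-one matrices \<open>cnj w n\<^sup>T\<close> and \<open>w n\<^sup>T\<close>, so that \<open>\<phi>\<close> is the form with the
     matrix \<open>\<Sum>\<^sub>k\<^sub>l A\<^sub>i\<^sub>j\<^sup>k\<^sup>l n\<^sub>k n\<^sub>l\<close>, and \<open>r\<close> is the part of \<open>Re F\<close> without derivatives of \<open>w\<close>.\<close>
  define cW where "cW y i k = cnj (W i y) * of_real (n k)" for y i k
  define nW where "nW y j l = W j y * of_real (n l)" for y j l
  define F where "F y = \<i> * tensor_form A (cW y) (d y)" for y
  define r where "r y = Re (\<i> * tensor_form A (cW y) (\<lambda>j l. of_real (\<xi> l) * W j y))" for y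
  define \<phi> where "\<phi> y = Re (tensor_form A (cW y) (nW y))" for y
  have cW_cnj: "cW y = (\<lambda>i k. cnj (nW y i k))" for y
    by (intro ext) (simp add: cW_def nW_def)
  have dW: "((\<lambda>s. cW s i k) has_vector_derivative cnj (W' i y) * of_real (n k)) (at y)"
    and dnW: "((\<lambda>s. nW s i k) has_vector_derivative W' i y * of_real (n k)) (at y)"
    and dd: "((\<lambda>s. d s i k) has_vector_derivative d' y i k) (at y)" if "0 < y" for y i k
    unfolding cW_def nW_def d_def d'_def
    by (auto intro!: derivative_eq_intros has_vector_derivative_cnj W W' that simp: mult.assoc)
  have F': "(F has_vector_derivative
      - (\<zeta> * (\<Sum>i\<in>UNIV. cnj (W i y) * W i y)
        + tensor_form A (\<lambda>i k. cnj (d y i k)) (d y))) (at y)" if "0 < y" for y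
  proof -
    have "(F has_vector_derivative \<i> * (tensor_form A (cW y) (d' y)
        + tensor_form A (\<lambda>i k. cnj (W' i y) * of_real (n k)) (d y))) (at y)"
      unfolding F_def
      by (intro has_vector_derivative_mult_right has_vector_derivative_tensor_form dW dd that)
    moreover have "\<i> * (tensor_form A (cW y) (d' y)
          + tensor_form A (\<lambda>i k. cnj (W' i y) * of_real (n k)) (d y))
        + tensor_form A (\<lambda>i k. cnj (d y i k)) (d y)
      = - (\<zeta> * (\<Sum>i\<in>UNIV. cnj (W i y) * W i y))" (is "?lhs = _")
    proof -
      \<comment> \<open>\<open>cnj d\<^sub>i\<^sub>k = \<xi>\<^sub>k cnj w\<^sub>i - \<i> n\<^sub>k cnj w\<^sub>i'\<close>: its second part cancels the terms with \<open>cnj w\<^sub>i'\<close>.\<close>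
      have "?lhs = (\<Sum>i\<in>UNIV. cnj (W i y) * (\<Sum>j\<in>UNIV. \<Sum>k\<in>UNIV. \<Sum>l\<in>UNIV.
        of_real (A i j k l) * (of_real (\<xi> k) * d y j l + \<i> * of_real (n k) * d' y j l)))"
        unfolding tensor_form_def sum_distrib_left sum.distrib[symmetric]
        by (intro sum.cong refl) (simp add: cW_def d_def algebra_simps)
      also have "\<dots> = (\<Sum>i\<in>UNIV. cnj (W i y) * - (\<zeta> * W i y))"
        using ode[OF that] by (intro sum.cong refl arg_cong2[of _ _ _ _ "(*)"])
          (simp add: eq_neg_iff_add_eq_0 add.commute)
      finally show ?thesis by (simp add: sum_negf sum_distrib_left mult.left_commute)
    qed
    then have "\<i> * (tensor_form A (cW y) (d' y)
          + tensor_form A (\<lambda>i k. cnj (W' i y) * of_real (n k)) (d y))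
      = - (\<zeta> * (\<Sum>i\<in>UNIV. cnj (W i y) * W i y)
          + tensor_form A (\<lambda>i k. cnj (d y i k)) (d y))"
      by (simp add: algebra_simps eq_neg_iff_add_eq_0)
    ultimately show ?thesis by simp
  qed
  have \<phi>': "(\<phi> has_real_derivative 2 * (r y - Re (F y))) (at y)" if "0 < y" for y
  proof -
    let ?T = "tensor_form A (cW y) (\<lambda>j l. W' j y * of_real (n l))"
    have "((\<lambda>s. tensor_form A (cW s) (nW s)) has_vector_derivative
        ?T + tensor_form A (\<lambda>i k. cnj (W' i y) * of_real (n k)) (nW y)) (at y)"
      by (intro has_vector_derivative_tensor_form dW dnW that)
    moreover have "tensor_form A (\<lambda>i k. cnj (W' i y) * of_real (n k)) (nW y) = cnj ?T"
      unfolding tensor_form_commute[OF sym, where G = "nW y"]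
      by (simp add: tensor_form_def cW_def nW_def)
    ultimately have "((\<lambda>s. tensor_form A (cW s) (nW s)) has_vector_derivative ?T + cnj ?T) (at y)"
      by simp
    then have "(\<phi> has_real_derivative Re (?T + cnj ?T)) (at y)"
      unfolding \<phi>_def has_real_derivative_iff_has_vector_derivative
      by (rule bounded_linear.has_vector_derivative[OF bounded_linear_Re])
    moreover have "F y = \<i> * tensor_form A (cW y) (\<lambda>j l. of_real (\<xi> l) * W j y) - ?T"
      by (simp add: F_def d_def tensor_form_def sum_distrib_left sum.distrib[symmetric]
          sum_subtractf[symmetric] algebra_simps)
    ultimately show ?thesis by (simp add: r_def)
  qed
  have Re_F': "((\<lambda>s. Re (F s)) has_real_derivative
      - (Re \<zeta> * (\<Sum>i\<in>UNIV. (cmod (W i y))\<^sup>2) 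
        + Re (tensor_form A (\<lambda>i k. cnj (d y i k)) (d y)))) (at y)" if "0 < y" for y
  proof -
    have "(\<Sum>i\<in>UNIV. cnj (W i y) * W i y) = of_real (\<Sum>i\<in>UNIV. (cmod (W i y))\<^sup>2)"
      by (simp add: mult.commute complex_norm_square del: of_real_power)
    then show ?thesis
      using bounded_linear.has_vector_derivative[OF bounded_linear_Re F'[OF that]]
      by (simp add: has_real_derivative_iff_has_vector_derivative)
  qed
  have mass_nonneg: "0 \<le> Re \<zeta> * (\<Sum>i\<in>UNIV. (cmod (W i y))\<^sup>2)" for y
    using \<zeta> by (intro mult_nonneg_nonneg sum_nonneg) auto
  have Re_F: "Re (F y) = 0" if "0 < y" for y
  proof (rule flux_vanishes[where f = "\<lambda>s. Re (F s)" and r = r and \<phi> = \<phi>])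
    fix s t :: real assume st: "0 < s" "s \<le> t"
    show "Re (F t) \<le> Re (F s)"
    proof (rule DERIV_nonpos_imp_nonincreasing[OF st(2), of "\<lambda>s. Re (F s)"])
      fix x assume "s \<le> x" "x \<le> t"
      then have "0 < x" using st by simp
      show "\<exists>D. ((\<lambda>s. Re (F s)) has_real_derivative D) (at x) \<and> D \<le> 0"
        using Re_F'[OF \<open>0 < x\<close>] mass_nonneg[of x] herm_nonneg[of "d x"]
        by (intro exI conjI) (assumption, linarith)
    qed
  next
    have lim0: "(\<phi> \<longlongrightarrow> 0) Fl" "(r \<longlongrightarrow> 0) Fl" if "\<And>j. (W j \<longlongrightarrow> 0) Fl" for Fl
      unfolding \<phi>_def r_def tensor_form_def cW_def nW_def
      by (rule tendsto_eq_intros that refl | simp)+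
    show "(\<phi> \<longlongrightarrow> 0) (at_right 0)" "(\<phi> \<longlongrightarrow> 0) at_top" "(r \<longlongrightarrow> 0) (at_right 0)" "(r \<longlongrightarrow> 0) at_top"
      by (intro lim0 W0 Winf)+
    show "0 \<le> \<phi> y" for y
      unfolding \<phi>_def cW_cnj by (rule herm_nonneg)
  qed (use \<phi>' that in auto)
  have skew: "d y i k + d y k i = 0" if "0 < y" for y i k
  proof -
    have "((\<lambda>s. Re (F s)) has_real_derivative 0) (at y)"
      by (rule has_field_derivative_transform_within_open[of "\<lambda>_. 0" _ _ "{0<..}"])
        (use Re_F that in auto)
    with Re_F'[OF that]
    have "Re \<zeta> * (\<Sum>i\<in>UNIV. (cmod (W i y))\<^sup>2)
        + Re (tensor_form A (\<lambda>i k. cnj (d y i k)) (d y)) = 0"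
      using DERIV_unique by fastforce
    then have "Re (tensor_form A (\<lambda>i k. cnj (d y i k)) (d y)) = 0"
      using mass_nonneg[of y] herm_nonneg[of "d y"] by linarith
    then have "tensor_form A (\<lambda>i k. Re (d y i k)) (\<lambda>i k. Re (d y i k)) = 0"
      "tensor_form A (\<lambda>i k. Im (d y i k)) (\<lambda>i k. Im (d y i k)) = 0"
      unfolding Re_tensor_form_cnj
      using nonneg[of "\<lambda>i k. Re (d y i k)"] nonneg[of "\<lambda>i k. Im (d y i k)"] by linarith+
    from this[THEN definite] show ?thesis by (simp add: complex_eq_iff)
  qed
  define Wn where "Wn y = (\<Sum>i\<in>UNIV. of_real (n i) * W i y)" for y
  define W'n where "W'n y = (\<Sum>i\<in>UNIV. of_real (n i) * W' i y)" for y
  define N where "N = (of_real (\<Sum>l\<in>UNIV. n l * n l) :: complex)"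
  have perp': "(\<Sum>l\<in>UNIV. of_real (\<xi> l) * of_real (n l)) = (0::complex)"
    using arg_cong[OF perp, of complex_of_real] by simp
  have N: "N \<noteq> 0" "N = (\<Sum>l\<in>UNIV. of_real (n l) * of_real (n l))"
    using n unfolding N_def by (simp only: of_real_eq_0_iff not_False_eq_True) simp
  \<comment> \<open>Contraction of the skewness relation with the normal; the product \<open>\<xi> \<bullet> n\<close> drops out.\<close>
  have traction: "of_real (\<xi> k) * Wn y + \<i> * of_real (n k) * W'n y + \<i> * N * W' k y = 0"
    if "0 < y" for y k
  proof -
    have "0 = (\<Sum>i\<in>UNIV. of_real (n i) * (d y i k + d y k i))"
      using skew[OF that] by simp
    also have "\<dots> = of_real (\<xi> k) * Wn y + \<i> * of_real (n k) * W'n y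
        + (\<Sum>l\<in>UNIV. of_real (\<xi> l) * of_real (n l)) * W k y + \<i> * N * W' k y"
      unfolding N(2) Wn_def W'n_def d_def sum_distrib_left sum_distrib_right sum.distrib[symmetric]
      by (intro sum.cong refl) (simp add: algebra_simps)
    finally show ?thesis using perp' by simp
  qed
  \<comment> \<open>Contracting with the normal once more leaves \<open>2 \<i> |n|\<^sup>2 (n \<bullet> w') = 0\<close>.\<close>
  have W'n: "W'n y = 0" if "0 < y" for y
  proof -
    have "0 = (\<Sum>k\<in>UNIV. of_real (n k) *
        (of_real (\<xi> k) * Wn y + \<i> * of_real (n k) * W'n y + \<i> * N * W' k y))"
      using traction[OF that] by simp
    also have "\<dots> = (\<Sum>l\<in>UNIV. of_real (\<xi> l) * of_real (n l)) * Wn y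
        + \<i> * (\<Sum>l\<in>UNIV. of_real (n l) * of_real (n l)) * W'n y
        + \<i> * N * (\<Sum>i\<in>UNIV. of_real (n i) * W' i y)"
      unfolding sum_distrib_left sum_distrib_right sum.distrib[symmetric]
      by (intro sum.cong refl) (simp add: algebra_simps)
    finally have "\<i> * N * W'n y + \<i> * N * W'n y = 0"
      unfolding perp' N(2)[symmetric] W'n_def[symmetric] by simp
    then show ?thesis using N(1) by simp
  qed
  have Wn: "Wn y = 0" if "0 < y" for y
  proof (rule constant_zero_on_half_line[OF _ _ that])
    fix y :: real assume "0 < y"
    have "(Wn has_vector_derivative W'n y) (at y)"
      unfolding Wn_def W'n_def
      by (intro has_vector_derivative_sum has_vector_derivative_mult_right W \<open>0 < y\<close>)
    with W'n[OF \<open>0 < y\<close>] show "(Wn has_vector_derivative 0) (at y)" by simp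
  next
    show "(Wn \<longlongrightarrow> 0) (at_right 0)"
      unfolding Wn_def by (rule tendsto_eq_intros W0 refl | simp)+
  qed
  show ?thesis
  proof (rule constant_zero_on_half_line[OF _ W0 \<open>0 < y\<close>])
    fix s :: real assume "0 < s"
    with traction[of s j] Wn[of s] W'n[of s] N(1) have "W' j s = 0" by simp
    with W[OF \<open>0 < s\<close>, of j] show "(W j has_vector_derivative 0) (at s)" by simp
  qed
qed

section \<open>The Lopatinskii-Shapiro condition from definiteness\<close>

text \<open>What remains is to identify the operators \<open>\<xi> - n D\<^sub>y\<close> and their compositions with the
  derivatives of the components of \<open>w\<close>. The inner operator has an explicit form at \<open>y > 0\<close>
  only, so the outer one is evaluated by locality of the derivative.\<close>

lemma lopatinskii_shapiro_dirichletI: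
  assumes A: "\<And>x. x \<in> frontier \<Omega> \<Longrightarrow> sym_definite (A x)"
    and normal: "\<And>x. x \<in> frontier \<Omega> \<Longrightarrow> outer_normal \<Omega> x \<noteq> 0"
  shows "lopatinskii_shapiro_dirichlet \<Omega> A"
  unfolding lopatinskii_shapiro_dirichlet_def
proof (intro ballI allI impI; elim conjE)
  fix x0 \<xi> \<zeta> w and y :: real
  let ?n = "outer_normal \<Omega> x0"
  assume x0: "x0 \<in> frontier \<Omega>" and perp: "\<xi> \<bullet> ?n = 0" and \<zeta>: "0 \<le> Re \<zeta>"
    and C0: "w \<in> C0_half_line" and diff: "twice_differentiable_pos w"
    and ode: "\<forall>y>0. \<zeta> *s w y + symbol_apply A x0 (half_line_covariable \<xi> ?n) w y = 0"
    and w0: "w 0 = 0" and "0 \<le> y"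
  define w' where "w' y = vector_derivative w (at y)" for y
  define w'' where "w'' y = vector_derivative w' (at y)" for y
  have dw: "(w has_vector_derivative w' y) (at y)"
    and dw': "(w' has_vector_derivative w'' y) (at y)" if "0 < y" for y
    using diff that
    by (auto simp: twice_differentiable_pos_def w'_def[abs_def] w''_def
        vector_derivative_works[symmetric])
  have comp: "((\<lambda>s. f s $ j) has_vector_derivative f' $ j) (at y)"
    if "(f has_vector_derivative f') (at y)" for f :: "real \<Rightarrow> complex^2" and f' j y
    by (rule bounded_linear.has_vector_derivative[OF bounded_linear_vec_nth that])
  have cov: "half_line_covariable \<xi> ?n l f y
      = of_real (\<xi> $ l) * f y + \<i> * of_real (?n $ l) * f'"
    if "(f has_vector_derivative f') (at y)" for f f' l y
    using vector_derivative_at[OF that] by (simp add: half_line_covariable_def D_y_def)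
  let ?d = "\<lambda>y j l. of_real (\<xi> $ l) * w y $ j + \<i> * of_real (?n $ l) * w' y $ j"
  let ?d' = "\<lambda>y j l. of_real (\<xi> $ l) * w' y $ j + \<i> * of_real (?n $ l) * w'' y $ j"
  have cov2: "half_line_covariable \<xi> ?n k (half_line_covariable \<xi> ?n l (\<lambda>s. w s $ j)) y
      = of_real (\<xi> $ k) * ?d y j l + \<i> * of_real (?n $ k) * ?d' y j l" if "0 < y" for y j k l
  proof -
    have first: "half_line_covariable \<xi> ?n l (\<lambda>s. w s $ j) s = ?d s j l" if "0 < s" for s
      by (rule cov[OF comp[OF dw[OF that]]])
    have "((\<lambda>s. ?d s j l) has_vector_derivative ?d' y j l) (at y)"
      by (intro has_vector_derivative_add has_vector_derivative_mult_right comp dw dw' that)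
    then have "(half_line_covariable \<xi> ?n l (\<lambda>s. w s $ j) has_vector_derivative ?d' y j l) (at y)"
      by (rule has_vector_derivative_transform_within_open[of _ _ _ "{0<..}"])
        (use that first in auto)
    from cov[OF this] show ?thesis by (simp add: first that)
  qed
  have cont: "continuous_on {0..} w" and inf: "(w \<longlongrightarrow> 0) at_top"
    using C0 by (auto simp: C0_half_line_def)
  have "(w \<longlongrightarrow> 0) (at 0 within {0..})"
    using cont w0 by (metis atLeast_iff continuous_on_def order_refl)
  then have right: "(w \<longlongrightarrow> 0) (at_right 0)"
    by (rule tendsto_within_subset) auto
  have "w y $ j = 0" if "0 < y" for j
  proof (rule half_line_uniqueness[OF A[OF x0], where \<xi> = "\<lambda>k. \<xi> $ k" and n = "\<lambda>k. ?n $ k"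
        and W = "\<lambda>j s. w s $ j" and W' = "\<lambda>j s. w' s $ j" and W'' = "\<lambda>j s. w'' s $ j"])
    show "(\<Sum>l\<in>UNIV. \<xi> $ l * ?n $ l) = 0"
      using perp by (simp add: inner_vec_def)
    show "(\<Sum>l\<in>UNIV. ?n $ l * ?n $ l) \<noteq> 0"
      using normal[OF x0] inner_eq_zero_iff[of ?n] by (simp add: inner_vec_def)
    show "\<zeta> * w s $ i + (\<Sum>j\<in>UNIV. \<Sum>k\<in>UNIV. \<Sum>l\<in>UNIV. of_real (A x0 i j k l) *
       (of_real (\<xi> $ k) * ?d s j l + \<i> * of_real (?n $ k) * ?d' s j l)) = 0"
      if "0 < s" for i s
      using ode[rule_format, OF that]
      by (simp add: symbol_apply_def cov2[OF that] vec_eq_iff)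
    show "((\<lambda>s. w s $ j) \<longlongrightarrow> 0) (at_right 0)" "((\<lambda>s. w s $ j) \<longlongrightarrow> 0) at_top" for j
      using tendsto_vec_nth[OF right, of j] tendsto_vec_nth[OF inf, of j] by simp_all
  qed (use \<zeta> that in \<open>auto intro: comp dw dw'\<close>)
  then show "w y = 0"
    using w0 \<open>0 \<le> y\<close> by (cases "y = 0") (auto simp: vec_eq_iff)
qed

section \<open>Definiteness of Hibler's tensor\<close>

text \<open>This is the bilinear form of the map \<open>S\<close>, diagonalised in the trace, the difference of the
  diagonal entries and the sum of the off-diagonal entries; as these combinations determine the
  symmetric part of a matrix, the kernel of the form can be read off.\<close>

definition strain_product :: "real \<Rightarrow> (2 \<Rightarrow> 2 \<Rightarrow> real) \<Rightarrow> (2 \<Rightarrow> 2 \<Rightarrow> real) \<Rightarrow> real" where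
  "strain_product e E G = (E 1 1 + E 2 2) * (G 1 1 + G 2 2) + 1 / e\<^sup>2 *
     ((E 1 1 - E 2 2) * (G 1 1 - G 2 2) + (E 1 2 + E 2 1) * (G 1 2 + G 2 1))"

lemma tensor_form_S_coeff: "tensor_form (S_coeff e) E G = strain_product e E G"
  by (simp add: tensor_form_def strain_product_def S_coeff_def hibler_S_def sum_2 axis_def
      algebra_simps)

lemma S_coeff_sym: "S_coeff e i j k l = S_coeff e j i l k"
  using exhaust_2[of i] exhaust_2[of j] exhaust_2[of k] exhaust_2[of l]
  by (auto simp: S_coeff_def hibler_S_def axis_def)

lemma hibler_S_pairing:
  "(\<Sum>i\<in>UNIV. \<Sum>k\<in>UNIV. hibler_S e \<epsilon> $ i $ k * E i k) = strain_product e (\<lambda>i k. \<epsilon> $ i $ k) E"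
  by (simp add: strain_product_def hibler_S_def sum_2 algebra_simps)

lemma triangle_sq_eq: "triangle_sq e \<epsilon> = strain_product e (\<lambda>i k. \<epsilon> $ i $ k) (\<lambda>i k. \<epsilon> $ i $ k)"
  by (simp add: triangle_sq_def tensor_form_S_coeff[symmetric] tensor_form_def mult_ac)

lemma strain_product_nonneg: "0 \<le> strain_product e E E"
  by (simp add: strain_product_def)

lemma strain_product_eq_0:
  assumes "e \<noteq> 0" "strain_product e E E = 0"
  shows "E i k + E k i = 0"
proof -
  have "(E 1 1 + E 2 2) * (E 1 1 + E 2 2) + 1 / e\<^sup>2 * 
     ((E 1 1 - E 2 2) * (E 1 1 - E 2 2) + (E 1 2 + E 2 1) * (E 1 2 + E 2 1)) = 0"
    using assms(2) by (simp add: strain_product_def)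
  then have "E 1 1 + E 2 2 = 0 \<and> (E 1 1 - E 2 2 = 0 \<and> E 1 2 + E 2 1 = 0)"
    using assms(1) by (simp add: add_nonneg_eq_0_iff)
  then show ?thesis
    using exhaust_2[of i] exhaust_2[of k] by auto
qed

lemma strain_product_Cauchy_Schwarz:
  "(strain_product e E G)\<^sup>2 \<le> strain_product e E E * strain_product e G G"
proof -
  define s where "s = 1 / e\<^sup>2"
  have "0 \<le> s" by (simp add: s_def)
  define a b c a' b' c' where
    "a = E 1 1 + E 2 2" "b = E 1 1 - E 2 2" "c = E 1 2 + E 2 1"
    "a' = G 1 1 + G 2 2" "b' = G 1 1 - G 2 2" "c' = G 1 2 + G 2 1"
  note defs = this
  \<comment> \<open>Lagrange's identity for the weights \<open>1, s, s\<close>.\<close>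
  have "strain_product e E E * strain_product e G G - (strain_product e E G)\<^sup>2
    = s * ((a * b' - b * a')\<^sup>2 + (a * c' - c * a')\<^sup>2) + s\<^sup>2 * (b * c' - c * b')\<^sup>2"
    unfolding strain_product_def defs[symmetric] s_def[symmetric] by algebra
  also have "\<dots> \<ge> 0" using \<open>0 \<le> s\<close> by simp
  finally show ?thesis by simp
qed

text \<open>Write \<open>b\<close> for the form of \<open>S\<close>. As \<open>\<triangle>\<^sub>\<delta>\<^sup>2 = \<delta> + b(\<epsilon>, \<epsilon>)\<close>, Cauchy--Schwarz gives
  \<open>\<triangle>\<^sub>\<delta>\<^sup>2 b(E, E) - b(\<epsilon>, E)\<^sup>2 \<ge> \<delta> b(E, E)\<close>. For \<open>\<delta> = 0\<close> the tensor would degenerate in the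
  direction \<open>E = \<epsilon>\<close>.\<close>

lemma sym_definite_hibler_coeff:
  assumes "0 < \<delta>" "0 < e" "0 < pstar" "0 < thick v x"
  shows "sym_definite (hibler_coeff \<delta> e pstar c \<Omega> v x)"
proof -
  define \<epsilon> where "\<epsilon> = strain \<Omega> (vel v) x"
  define t where "t = triangle_delta \<delta> e \<epsilon>"
  define \<alpha> where "\<alpha> = ice_strength pstar c (thick v x) (conc v x) / (2 * t)"
  let ?b = "strain_product e" and ?\<epsilon> = "\<lambda>i k. \<epsilon> $ i $ k"
  have t2: "t\<^sup>2 = \<delta> + ?b ?\<epsilon> ?\<epsilon>"
    using assms(1) strain_product_nonneg[of e ?\<epsilon>]
    by (simp add: t_def triangle_delta_def triangle_sq_eq)
  have "0 < t"
    using assms(1) strain_product_nonneg[of e ?\<epsilon>]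
    by (simp add: t_def triangle_delta_def triangle_sq_eq)
  have "0 < \<alpha>"
    using assms(3,4) \<open>0 < t\<close> by (simp add: \<alpha>_def ice_strength_def)
  have coeff: "hibler_coeff \<delta> e pstar c \<Omega> v x i j k l =
      \<alpha> * (S_coeff e i j k l - 1 / t\<^sup>2 * (hibler_S e \<epsilon> $ i $ k) * (hibler_S e \<epsilon> $ j $ l))"
    for i j k l
    by (simp add: hibler_coeff_def \<alpha>_def t_def \<epsilon>_def Let_def)
  have form: "tensor_form (hibler_coeff \<delta> e pstar c \<Omega> v x) E E
      = \<alpha> * (?b E E - 1 / t\<^sup>2 * (?b ?\<epsilon> E)\<^sup>2)" for E
    unfolding tensor_form_S_coeff[symmetric, of e E E] hibler_S_pairing[symmetric]
    unfolding tensor_form_def coeff sum_2 power2_eq_square of_real_eq_id id_apply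
    by (simp add: algebra_simps)
  have lower: "\<alpha> * \<delta> / t\<^sup>2 * ?b E E \<le> tensor_form (hibler_coeff \<delta> e pstar c \<Omega> v x) E E" for E
  proof -
    have "\<delta> * ?b E E \<le> t\<^sup>2 * ?b E E - (?b ?\<epsilon> E)\<^sup>2"
      using strain_product_Cauchy_Schwarz[of e ?\<epsilon> E] by (simp add: t2 algebra_simps)
    then have "\<alpha> / t\<^sup>2 * (\<delta> * ?b E E) \<le> \<alpha> / t\<^sup>2 * (t\<^sup>2 * ?b E E - (?b ?\<epsilon> E)\<^sup>2)"
      using \<open>0 < \<alpha>\<close> by (intro mult_left_mono) auto
    then show ?thesis
      unfolding form using \<open>0 < t\<close> by (simp add: field_simps)
  qed
  have "0 < \<alpha> * \<delta> / t\<^sup>2" using \<open>0 < \<alpha>\<close> \<open>0 < t\<close> assms(1) by simp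
  show ?thesis
    unfolding sym_definite_def
  proof (intro conjI allI impI)
    show "hibler_coeff \<delta> e pstar c \<Omega> v x i j k l = hibler_coeff \<delta> e pstar c \<Omega> v x j i l k" for i j k l
      by (simp add: coeff S_coeff_sym[of e i j k l])
    show "0 \<le> tensor_form (hibler_coeff \<delta> e pstar c \<Omega> v x) E E" for E :: "2 \<Rightarrow> 2 \<Rightarrow> real"
      using lower[of E] \<open>0 < \<alpha> * \<delta> / t\<^sup>2\<close> strain_product_nonneg[of e E]
      by (meson mult_nonneg_nonneg order_trans less_imp_le)
    show "E i k + E k i = 0" if "tensor_form (hibler_coeff \<delta> e pstar c \<Omega> v x) E E = 0" for E :: "2 \<Rightarrow> 2 \<Rightarrow> real" and i k
    proof (rule strain_product_eq_0)
      have "\<alpha> * \<delta> / t\<^sup>2 * ?b E E \<le> 0" using lower[of E] that by simp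
      then show "?b E E = 0"
        using \<open>0 < \<alpha> * \<delta> / t\<^sup>2\<close> strain_product_nonneg[of e E]
        by (metis antisym mult_le_0_iff not_le)
    qed (use assms in simp)
  qed
qed

section \<open>The outer normal and the ice thickness at the boundary\<close>

text \<open>The normal is a choice over all graph representations. A point of the boundary has a graph
  representation, and the isometry \<open>T\<close> in it is onto, so the choice is not vacuous.\<close>

lemma norm_outer_normal:
  assumes "bounded_C2_domain \<Omega>" "x \<in> frontier \<Omega>"
  shows "norm (outer_normal \<Omega> x) = 1"
proof -
  let ?N = "\<lambda>g T. (1 / sqrt (1 + (deriv g (T x $ 1))\<^sup>2)) *\<^sub>R vector [deriv g (T x $ 1), - 1] :: real^2"
  obtain r g T where graph: "C2_graph_at \<Omega> x r g T"
    using assms unfolding bounded_C2_domain_def by blast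
  then have "surj T"
    by (auto simp: C2_graph_at_def orthogonal_transformation_surj)
  then obtain n where "T n = ?N g T" by (metis surjD)
  with graph have "\<exists>n. \<exists>r g T. C2_graph_at \<Omega> x r g T \<and> T n = ?N g T" by blast
  from someI_ex[OF this] obtain r g T
    where g: "C2_graph_at \<Omega> x r g T" and n: "T (outer_normal \<Omega> x) = ?N g T"
    unfolding outer_normal_def by blast
  have "norm (outer_normal \<Omega> x) = norm (?N g T)"
    using g n by (metis C2_graph_at_def orthogonal_transformation_norm)
  also have "\<dots> = 1"
  proof -
    have "norm (vector [a, - 1] :: real^2) = sqrt (1 + a\<^sup>2)" for a :: real
      by (simp add: norm_vec_def L2_set_def sum_2 add.commute)
    moreover have "sqrt (1 + a\<^sup>2) \<noteq> 0" for a :: real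
      by (simp add: add_nonneg_eq_0_iff)
    ultimately show ?thesis by simp
  qed
  finally show ?thesis .
qed

text \<open>The points of \<open>\<Omega>\<close> where the bound fails form an open null set, which is empty.\<close>

lemma AE_lower_bound_closure:
  fixes f :: "'a::euclidean_space \<Rightarrow> real"
  assumes "open \<Omega>" "continuous_on (closure \<Omega>) f"
    and "AE x in lebesgue_on \<Omega>. \<kappa> \<le> f x" and "x \<in> closure \<Omega>"
  shows "\<kappa> \<le> f x"
proof -
  have cont: "continuous_on \<Omega> f"
    using assms(2) closure_subset continuous_on_subset by blast
  let ?U = "{x\<in>\<Omega>. f x < \<kappa>}"
  have "open ?U"
    using continuous_open_preimage[OF cont assms(1), of "{..<\<kappa>}"]
    by (simp add: vimage_def Int_def conj_commute)
  have "AE x in lebesgue. x \<notin> ?U"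
    using assms(3) \<open>open \<Omega>\<close> by (auto simp: AE_restrict_space_iff elim: AE_mp)
  then have "negligible ?U"
    using \<open>open ?U\<close> by (subst negligible_iff_null_sets) (auto simp: AE_iff_null_sets)
  then have "?U = {}"
    using open_not_negligible[OF \<open>open ?U\<close>] by blast
  then have "\<And>x. x \<in> \<Omega> \<Longrightarrow> \<kappa> \<le> f x" by force
  then show ?thesis
    using continuous_ge_on_closure[OF assms(2,4)] by blast
qed

theorem proposition4p3:
  fixes \<Omega> :: "(real^2) set"
    and p q \<mu> \<kappa> \<delta> e pstar c :: real
    and V :: "state set"
    and v v0 :: state
  assumes "bounded_C2_domain \<Omega>"
    and "1 < p" and "1 < q"
    and "1 / p < \<mu>" and "\<mu> \<le> 1"
    and "1 / 2 + 1 / p + 1 / q < \<mu>"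
    and "\<delta> > 0" and "e > 0" and "pstar > 0" and "c > 0"
    and "open_in_X_gamma \<Omega> p q \<mu> V"
    and "\<kappa> > 0"
    and "\<forall>z\<in>V. AE x in lebesgue_on \<Omega>. thick z x \<ge> \<kappa> \<and> conc z x \<in> {0..1}"
    and "v \<in> V" and "C1_representative \<Omega> v v0"
  shows "lopatinskii_shapiro_dirichlet \<Omega> (hibler_coeff \<delta> e pstar c \<Omega> v0)"
proof (rule lopatinskii_shapiro_dirichletI)
  fix x assume x: "x \<in> frontier \<Omega>"
  show "outer_normal \<Omega> x \<noteq> 0"
    using norm_outer_normal[OF \<open>bounded_C2_domain \<Omega>\<close> x] by auto
  have "\<kappa> \<le> thick v0 x"
  proof (rule AE_lower_bound_closure[where f = "thick v0" and \<Omega> = \<Omega>])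
    show "open \<Omega>" using \<open>bounded_C2_domain \<Omega>\<close> by (simp add: bounded_C2_domain_def)
    have "continuous_on (closure \<Omega>) v0"
      using \<open>C1_representative \<Omega> v v0\<close> by (simp add: C1_representative_def C1_closure_def)
    then show "continuous_on (closure \<Omega>) (thick v0)"
      unfolding thick_def[abs_def] by (intro continuous_intros)
    have "AE x in lebesgue_on \<Omega>. thick v x \<ge> \<kappa> \<and> conc v x \<in> {0..1}"
      using assms(13) \<open>v \<in> V\<close> by blast
    moreover have "AE x in lebesgue_on \<Omega>. v0 x = v x"
      using \<open>C1_representative \<Omega> v v0\<close> by (simp add: C1_representative_def)
    ultimately show "AE x in lebesgue_on \<Omega>. \<kappa> \<le> thick v0 x"
      by eventually_elim (simp add: thick_def)
    show "x \<in> closure \<Omega>" using x by (simp add: frontier_def)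
  qed
  with \<open>\<kappa> > 0\<close> show "sym_definite (hibler_coeff \<delta> e pstar c \<Omega> v0 x)"
    by (intro sym_definite_hibler_coeff assms) simp
qed

end
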